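(* Let $w:\{0,1,2,\ldots\}\to(0,\infty)$ be an increasing function such that $w(n)\to\infty$ as $n\to\infty$, and let $\{Z_t,\ t=0,1,\ldots\}$ be the vertex-repelling random walk on $\mathbb{Z}$ with weight function $w$. Then $$\mathbb{P}\left(\exists\, t_0>0,\ k\le \ell:\ Z_t\in\{k,\ldots,\ell\}\ \text{ for all } t\ge t_0\right)=0,$$ where $k,\ell$ range over the integers.
   Context: The vertex-repelling random walk with weight function $w$ is the (non-Markovian) integer-valued process $(Z_t)_{t\ge 0}$, started from an integer $Z_0$, such that, conditionally on $Z_0,\ldots,Z_t$, $$Z_{t+1}=\begin{cases} Z_t-1 & \text{with probability } \dfrac{w(\widetilde R_t)}{w(\widetilde L_t)+w(\widetilde R_t)},\\[2mm] Z_t+1 & \text{with probability } \dfrac{w(\widetilde L_t)}{w(\widetilde L_t)+w(\widetilde R_t)},\end{cases}$$ where $\widetilde R_t:=\#\{s<t: Z_s=Z_t+1\}$ and $\widetilde L_t:=\#\{s<t: Z_s=Z_t-1\}$ are the numbers of previous visits to the right and left neighbours of the current position, and $\#S$ is the number of elements of a finite set $S$. *)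

theory Defs
  imports "HOL-Probability.Probability"
begin

definition visits :: "(nat \<Rightarrow> int) \<Rightarrow> nat \<Rightarrow> int \<Rightarrow> nat" where
  "visits z t v = card {s. s < t \<and> z s = v}"

text \<open>
  Conditioning on \<open>Z\<^sub>0, \<dots>, Z\<^sub>t\<close> is expressed by elementary conditional probabilities given each
  initial segment \<open>z 0, \<dots>, z t\<close> of positive probability, which is equivalent to conditioning on the
  generated sigma-algebra because the \<open>Z\<^sub>s\<close> take countably many values. Only the values
  \<open>z s\<close> with \<open>s \<le> t\<close> matter below. The starting point \<open>Z\<^sub>0\<close> may be any integer-valued
  random variable, in particular a constant.
\<close>

locale vertex_repelling_walk = prob_space M
  for M :: "'a measure" and w :: "nat \<Rightarrow> real" and Z :: "nat \<Rightarrow> 'a \<Rightarrow> int" +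
  assumes measurable_Z: "\<And>t. Z t \<in> measurable M (count_space UNIV)"
    and step_left: "\<And>t z. \<P>(\<omega> in M. \<forall>s\<le>t. Z s \<omega> = z s) > 0 \<Longrightarrow>
      \<P>(\<omega> in M. Z (Suc t) \<omega> = z t - 1 \<bar> \<forall>s\<le>t. Z s \<omega> = z s) =
        w (visits z t (z t + 1)) / (w (visits z t (z t - 1)) + w (visits z t (z t + 1)))"
    and step_right: "\<And>t z. \<P>(\<omega> in M. \<forall>s\<le>t. Z s \<omega> = z s) > 0 \<Longrightarrow>
      \<P>(\<omega> in M. Z (Suc t) \<omega> = z t + 1 \<bar> \<forall>s\<le>t. Z s \<omega> = z s) =
        w (visits z t (z t - 1)) / (w (visits z t (z t - 1)) + w (visits z t (z t + 1)))"

end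

(* Take the least site k that is visited infinitely often by a trapped walk. From some time T on, the
   site k - 1 is never visited, so its visit count stays at most T, and each step from k goes left with
   conditional probability at least p = w 0 / (w T + w 0) > 0. Hence the probability that the walk
   stays at or above k from time T until its n-th return to k is at most (1 - p)^n, which tends to 0.
   A countable union over T and k finishes the proof. *)

theory Submission
  imports Defs
begin

section \<open>Summing measure bounds over disjoint events\<close>

text \<open>Disjointness passes from the \<open>A i\<close> to the smaller \<open>C i\<close>, so
  both measures are sums over \<open>I\<close>. This serves twice: to pass from single histories to
  a fixed time, and from fixed times to the random time of a visit.\<close>

lemma emeasure_UN_le_cmult:
  assumes "countable I"
    and "\<And>i. i \<in> I \<Longrightarrow> A i \<in> sets M" "\<And>i. i \<in> I \<Longrightarrow> C i \<in> sets M"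
    and "\<And>i. i \<in> I \<Longrightarrow> C i \<subseteq> A i" "disjoint_family_on A I"
    and "\<And>i. i \<in> I \<Longrightarrow> emeasure M (C i) \<le> c * emeasure M (A i)"
  shows "emeasure M (\<Union>i\<in>I. C i) \<le> c * emeasure M (\<Union>i\<in>I. A i)"
proof -
  have "disjoint_family_on C I"
    using assms(4,5) unfolding disjoint_family_on_def by blast
  then have "emeasure M (\<Union>i\<in>I. C i) = (\<integral>\<^sup>+i. emeasure M (C i) \<partial>count_space I)"
    using assms by (intro emeasure_UN_countable) auto
  also have "\<dots> \<le> (\<integral>\<^sup>+i. c * emeasure M (A i) \<partial>count_space I)"
    using assms(6) by (intro nn_integral_mono) auto
  also have "\<dots> = c * emeasure M (\<Union>i\<in>I. A i)"
    using assms by (simp add: nn_integral_cmult emeasure_UN_countable)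
  finally show ?thesis .
qed

section \<open>Visits to a level by deterministic paths\<close>

text \<open>Visits to \<open>k\<close> from time \<open>T\<close> on are numbered from 0, since the
  count leaves out \<open>t\<close>. Only times up to \<open>t\<close> enter, so the condition is
  decided by the history at time \<open>t\<close>.\<close>

definition low_hit :: "int \<Rightarrow> nat \<Rightarrow> nat \<Rightarrow> nat \<Rightarrow> (nat \<Rightarrow> int) \<Rightarrow> bool" where
  "low_hit k T n t z \<longleftrightarrow>
     T \<le> t \<and> z t = k \<and> (\<forall>s\<in>{T..t}. k \<le> z s) \<and> card {s\<in>{T..<t}. z s = k} = n"

lemma low_hit_cong:
  assumes "\<And>s. s \<le> t \<Longrightarrow> z s = z' s"
  shows "low_hit k T n t z \<longleftrightarrow> low_hit k T n t z'"
proof -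
  have "{s\<in>{T..<t}. z s = k} = {s\<in>{T..<t}. z' s = k}"
    using assms by auto
  then show ?thesis
    using assms unfolding low_hit_def by auto
qed

text \<open>The count at the later of two such times would also include the earlier one. This makes
  the events for different \<open>t\<close> disjoint.\<close>

lemma low_hit_unique:
  assumes "low_hit k T n t z" "low_hit k T n t' z"
  shows "t = t'"
proof -
  have less: False if "low_hit k T n t z" "low_hit k T n t' z" "t < t'" for t t'
  proof -
    have "{s\<in>{T..<t}. z s = k} \<subset> {s\<in>{T..<t'}. z s = k}"
      using that unfolding low_hit_def by auto
    then have "card {s\<in>{T..<t}. z s = k} < card {s\<in>{T..<t'}. z s = k}"
      by (intro psubset_card_mono) auto
    then show False
      using that unfolding low_hit_def by auto
  qed
  show ?thesis
    using less[OF assms] less[OF assms(2,1)] by (cases rule: linorder_cases) auto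
qed

text \<open>The witness is the preceding visit to \<open>k\<close>. One step later, still no later
  than \<open>t'\<close>, the path is at or above \<open>k\<close>, so it did not step left. Each
  further visit thus costs one avoided left step.\<close>

lemma low_hit_Suc_imp:
  assumes "low_hit k T (Suc n) t' z"
  shows "\<exists>t. low_hit k T n t z \<and> z (Suc t) \<noteq> z t - 1"
proof -
  define S where "S = {s\<in>{T..<t'}. z s = k}"
  have cS: "card S = Suc n" and fin: "finite S"
    using assms unfolding low_hit_def S_def by auto
  then have "S \<noteq> {}" by auto
  define t where "t = Max S"
  have t: "t \<in> S" and max: "\<And>s. s \<in> S \<Longrightarrow> s \<le> t"
    using fin \<open>S \<noteq> {}\<close> unfolding t_def by auto
  have "{s\<in>{T..<t}. z s = k} = S - {t}"
    using t max unfolding S_def by force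
  then have "card {s\<in>{T..<t}. z s = k} = n"
    using cS t by simp
  then have "low_hit k T n t z"
    using assms t unfolding low_hit_def S_def by auto
  moreover have "z t = k" "k \<le> z (Suc t)"
    using assms t unfolding low_hit_def S_def by auto
  then have "z (Suc t) \<noteq> z t - 1" by simp
  ultimately show ?thesis by blast
qed

lemma low_hit_exists:
  assumes "\<And>s. T \<le> s \<Longrightarrow> k \<le> z s" and inf: "\<exists>\<^sub>\<infinity>s. z s = k"
  shows "\<exists>t. low_hit k T n t z"
proof -
  have next_hit: "\<exists>t\<ge>u. z t = k \<and> (\<forall>s. u \<le> s \<and> s < t \<longrightarrow> z s \<noteq> k)" for u
  proof -
    have "\<exists>t. u \<le> t \<and> z t = k"
      using inf unfolding INFM_nat_le by blast
    from exists_least_iff[THEN iffD1, OF this] show ?thesis by blast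
  qed
  show ?thesis
  proof (induction n)
    case 0
    obtain t where t: "T \<le> t" "z t = k" "\<And>s. T \<le> s \<Longrightarrow> s < t \<Longrightarrow> z s \<noteq> k"
      using next_hit[of T] by blast
    then have "{s\<in>{T..<t}. z s = k} = {}" by auto
    then have "card {s\<in>{T..<t}. z s = k} = 0" by simp
    with t(1,2) have "low_hit k T 0 t z"
      using assms(1) unfolding low_hit_def by simp
    then show ?case ..
  next
    case (Suc n)
    then obtain u where u: "low_hit k T n u z" ..
    obtain t where t: "Suc u \<le> t" "z t = k" "\<And>s. Suc u \<le> s \<Longrightarrow> s < t \<Longrightarrow> z s \<noteq> k"
      using next_hit[of "Suc u"] by blast
    have uT: "T \<le> u" "z u = k" "card {s\<in>{T..<u}. z s = k} = n"
      using u unfolding low_hit_def by auto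
    \<comment> \<open>No visit falls strictly between \<open>u\<close> and \<open>t\<close>, so the
      count grows by exactly one, namely by \<open>u\<close>.\<close>
    have "s = u \<or> s < u" if "s < t" "z s = k" for s
      using t(3)[of s] that by linarith
    then have "{s\<in>{T..<t}. z s = k} = insert u {s\<in>{T..<u}. z s = k}"
      using t(1) uT(1,2) by auto
    then have "card {s\<in>{T..<t}. z s = k} = Suc n"
      using uT(3) by simp
    moreover have "T \<le> t"
      using t(1) uT(1) by linarith
    ultimately have "low_hit k T (Suc n) t z"
      using assms(1) t(2) unfolding low_hit_def by simp
    then show ?case ..
  qed
qed

text \<open>The path avoids \<open>k - 1\<close> from \<open>T\<close> up to \<open>t\<close>, so
  only the \<open>T\<close> earlier times can contribute. The bound does not grow with
  \<open>t\<close>.\<close>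

lemma visits_below_le:
  assumes "low_hit k T n t z"
  shows "visits z t (k - 1) \<le> T"
proof -
  have "k \<le> z s" if "T \<le> s" "s < t" for s
    using assms that unfolding low_hit_def by auto
  then have "{s. s < t \<and> z s = k - 1} \<subseteq> {..<T}"
    by (fastforce simp: not_less[symmetric])
  then have "card {s. s < t \<and> z s = k - 1} \<le> card {..<T}"
    by (intro card_mono) auto
  then show ?thesis
    unfolding visits_def by simp
qed

lemma bounded_path_least_recurrent:
  fixes z :: "nat \<Rightarrow> int"
  assumes "\<And>t. t0 \<le> t \<Longrightarrow> z t \<in> {k..l}"
  shows "\<exists>m T. (\<forall>s\<ge>T. m \<le> z s) \<and> (\<exists>\<^sub>\<infinity>s. z s = m)"
proof -
  define V where "V = {v\<in>{k..l}. \<exists>\<^sub>\<infinity>s. z s = v}"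
  have ev: "\<forall>\<^sub>F t in sequentially. z t \<in> {k..l}"
    using assms by (auto simp: eventually_sequentially)
  have rare: "\<forall>\<^sub>F t in sequentially. z t \<noteq> v" if "v \<in> {k..l} - V" for v
    using that unfolding V_def by (auto simp: frequently_def cofinite_eq_sequentially)
  have ev_V: "\<forall>\<^sub>F t in sequentially. z t \<in> V"
  proof -
    \<comment> \<open>Only finitely many values are not recurrent, so from some time on all of them
      are absent at once.\<close>
    have "\<forall>\<^sub>F t in sequentially. \<forall>v\<in>{k..l} - V. z t \<noteq> v"
      using rare by (intro eventually_ball_finite) auto
    with ev show ?thesis
      by eventually_elim auto
  qed
  then have "V \<noteq> {}"
    by auto
  moreover have fin: "finite V"
    unfolding V_def by (rule finite_subset[of _ "{k..l}"]) auto
  ultimately have "Min V \<in> V" by (intro Min_in)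
  moreover obtain T where "\<And>s. T \<le> s \<Longrightarrow> z s \<in> V"
    using ev_V unfolding eventually_sequentially by blast
  ultimately show ?thesis
    using fin unfolding V_def by (intro exI[of _ "Min V"] exI[of _ T]) (auto simp: V_def)
qed

section \<open>Probability estimates for the walk\<close>

context vertex_repelling_walk
begin

lemma sets_Collect_Z [measurable]: "Measurable.pred M (\<lambda>\<omega>. Q (Z t \<omega>))"
  using measurable_compose[OF measurable_Z[of t], of Q "count_space UNIV"] by simp

lemma sets_Collect_prefix: "{\<omega>\<in>space M. \<forall>s\<le>t. Z s \<omega> = z s} \<in> sets M"
  by measurable

text \<open>Histories are indexed by lists because, unlike infinite paths, these are countable.
  Entries of \<open>xs ! s\<close> beyond \<open>t\<close> are unspecified, hence the hypothesis
  that \<open>Q\<close> ignores them. \<open>R\<close> leaves room for a condition on the next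
  step.\<close>

lemma prefix_decomposition:
  assumes "\<And>z z'. (\<And>s. s \<le> t \<Longrightarrow> z s = z' s) \<Longrightarrow> Q z \<longleftrightarrow> Q z'"
  shows "{\<omega>\<in>space M. Q (\<lambda>s. Z s \<omega>) \<and> R \<omega>} =
    (\<Union>xs\<in>{xs. length xs = Suc t \<and> Q ((!) xs)}. {\<omega>\<in>space M. (\<forall>s\<le>t. Z s \<omega> = xs ! s) \<and> R \<omega>})"
    (is "?L = ?R")
proof (intro set_eqI iffI)
  fix \<omega> assume \<omega>: "\<omega> \<in> ?L"
  have nth: "map (\<lambda>s. Z s \<omega>) [0..<Suc t] ! s = Z s \<omega>" if "s \<le> t" for s
    using that by (simp del: upt_Suc)
  then have "Q ((!) (map (\<lambda>s. Z s \<omega>) [0..<Suc t]))"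
    using \<omega> assms[of "(!) (map (\<lambda>s. Z s \<omega>) [0..<Suc t])" "\<lambda>s. Z s \<omega>"] by blast
  with \<omega> nth show "\<omega> \<in> ?R"
    by (intro UN_I[of "map (\<lambda>s. Z s \<omega>) [0..<Suc t]"]) (auto simp del: upt_Suc)
next
  fix \<omega> assume "\<omega> \<in> ?R"
  then obtain xs where "Q ((!) xs)" "\<omega> \<in> space M" "\<And>s. s \<le> t \<Longrightarrow> Z s \<omega> = xs ! s" "R \<omega>"
    by auto
  with assms[of "(!) xs" "\<lambda>s. Z s \<omega>"] show "\<omega> \<in> ?L" by auto
qed

lemma sets_Collect_adapted:
  assumes "\<And>z z'. (\<And>s. s \<le> t \<Longrightarrow> z s = z' s) \<Longrightarrow> Q z \<longleftrightarrow> Q z'"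
  shows "{\<omega>\<in>space M. Q (\<lambda>s. Z s \<omega>)} \<in> sets M"
  using prefix_decomposition[of t Q "\<lambda>_. True", OF assms] sets_Collect_prefix
  by (auto intro!: sets.countable_UN')

text \<open>On each single history satisfying \<open>Q\<close>, the law of the walk gives a left
  step with conditional probability at least \<open>p\<close>; summing over the disjoint histories
  yields the bound.\<close>

lemma not_left_step_le:
  assumes adapted: "\<And>z z'. (\<And>s. s \<le> t \<Longrightarrow> z s = z' s) \<Longrightarrow> Q z \<longleftrightarrow> Q z'"
    and p: "p \<le> 1"
    and left: "\<And>z. Q z \<Longrightarrow>
      p \<le> w (visits z t (z t + 1)) / (w (visits z t (z t - 1)) + w (visits z t (z t + 1)))"
  shows "emeasure M {\<omega>\<in>space M. Q (\<lambda>s. Z s \<omega>) \<and> Z (Suc t) \<omega> \<noteq> Z t \<omega> - 1}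
    \<le> ennreal (1 - p) * emeasure M {\<omega>\<in>space M. Q (\<lambda>s. Z s \<omega>)}"
proof -
  define I :: "int list set" where "I = {xs. length xs = Suc t \<and> Q ((!) xs)}"
  define A where "A xs = {\<omega>\<in>space M. \<forall>s\<le>t. Z s \<omega> = xs ! s}" for xs
  define C where "C xs = {\<omega>\<in>space M. (\<forall>s\<le>t. Z s \<omega> = xs ! s) \<and> Z (Suc t) \<omega> \<noteq> Z t \<omega> - 1}" for xs
  have A_sets: "A xs \<in> sets M" for xs
    unfolding A_def by measurable
  have C_eq: "C xs = A xs - {\<omega>\<in>space M. Z (Suc t) \<omega> = xs ! t - 1}" for xs
    unfolding A_def C_def by auto
  have D_sets: "{\<omega>\<in>space M. Z (Suc t) \<omega> = xs ! t - 1} \<in> sets M" for xs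
    by measurable
  have C_sets: "C xs \<in> sets M" for xs
    unfolding C_eq using A_sets D_sets by blast
  have "disjoint_family_on A I"
    unfolding disjoint_family_on_def A_def I_def
    by (auto simp: less_Suc_eq_le intro!: nth_equalityI)
  moreover have "emeasure M (C xs) \<le> ennreal (1 - p) * emeasure M (A xs)" if "xs \<in> I" for xs
  proof -
    have "measure M (C xs) \<le> (1 - p) * measure M (A xs)"
    proof (cases "measure M (A xs) > 0")
      case True
      have eq: "{\<omega>\<in>space M. Z (Suc t) \<omega> = xs ! t - 1 \<and> (\<forall>s\<le>t. Z s \<omega> = xs ! s)} =
          A xs \<inter> {\<omega>\<in>space M. Z (Suc t) \<omega> = xs ! t - 1}"
        unfolding A_def by auto
      have "p \<le> \<P>(\<omega> in M. Z (Suc t) \<omega> = xs ! t - 1 \<bar> \<forall>s\<le>t. Z s \<omega> = xs ! s)"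
        using step_left[of t "(!) xs"] left[of "(!) xs"] True that
        unfolding A_def I_def by simp
      then have "p * measure M (A xs) \<le> measure M (A xs \<inter> {\<omega>\<in>space M. Z (Suc t) \<omega> = xs ! t - 1})"
        using True unfolding cond_prob_def eq by (simp add: A_def[symmetric] field_simps)
      moreover have "measure M (C xs) =
          measure M (A xs) - measure M (A xs \<inter> {\<omega>\<in>space M. Z (Suc t) \<omega> = xs ! t - 1})"
        unfolding C_eq by (intro finite_measure_Diff' A_sets D_sets)
      ultimately show ?thesis
        by (simp add: algebra_simps)
    next
      \<comment> \<open>Nothing is known about the next step after a null history, but then
        \<open>C xs\<close> is null as well.\<close>
      case False
      moreover have "measure M (C xs) \<le> measure M (A xs)"
        unfolding C_eq by (intro finite_measure_mono A_sets) auto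
      ultimately show ?thesis
        by (simp add: zero_less_measure_iff)
    qed
    then show ?thesis
      using p by (simp add: emeasure_eq_measure flip: ennreal_mult)
  qed
  ultimately have "emeasure M (\<Union>xs\<in>I. C xs) \<le> ennreal (1 - p) * emeasure M (\<Union>xs\<in>I. A xs)"
    using A_sets C_sets C_eq by (intro emeasure_UN_le_cmult) auto
  moreover have "{\<omega>\<in>space M. Q (\<lambda>s. Z s \<omega>) \<and> Z (Suc t) \<omega> \<noteq> Z t \<omega> - 1} = (\<Union>xs\<in>I. C xs)"
    unfolding I_def C_def by (rule prefix_decomposition[OF adapted])
  moreover have "{\<omega>\<in>space M. Q (\<lambda>s. Z s \<omega>)} = (\<Union>xs\<in>I. A xs)"
    using prefix_decomposition[of t Q "\<lambda>_. True", OF adapted] unfolding I_def A_def by simp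
  ultimately show ?thesis by simp
qed

lemma AE_not_recurrent_minimum:
  assumes pos: "\<And>n. w n > 0" and "mono w"
  shows "AE \<omega> in M. \<not> ((\<forall>s\<ge>T. k \<le> Z s \<omega>) \<and> (\<exists>\<^sub>\<infinity>s. Z s \<omega> = k))"
proof -
  \<comment> \<open>The worst case for a left step: least weight \<open>w 0\<close> on the right
    count, largest weight \<open>w T\<close> on the left count, which is at most
    \<open>T\<close>.\<close>
  define p where "p = w 0 / (w T + w 0)"
  have p: "0 < p" "p \<le> 1"
    unfolding p_def using pos[of 0] pos[of T] by (auto simp: field_simps)
  define H where "H n t = {\<omega>\<in>space M. low_hit k T n t (\<lambda>s. Z s \<omega>)}" for n t
  define G where "G n t = {\<omega>\<in>space M. low_hit k T n t (\<lambda>s. Z s \<omega>) \<and> Z (Suc t) \<omega> \<noteq> Z t \<omega> - 1}" for n t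
  have H_sets: "H n t \<in> sets M" for n t
    unfolding H_def by (intro sets_Collect_adapted[of t] low_hit_cong)
  have G_sets: "G n t \<in> sets M" for n t
  proof -
    have "G n t = H n t \<inter> {\<omega>\<in>space M. Z (Suc t) \<omega> \<noteq> Z t \<omega> - 1}"
      unfolding G_def H_def by auto
    moreover have "{\<omega>\<in>space M. Z (Suc t) \<omega> \<noteq> Z t \<omega> - 1} \<in> sets M"
      using measurable_Z[of t] measurable_Z[of "Suc t"] by measurable
    ultimately show ?thesis
      using H_sets by auto
  qed
  have step: "emeasure M (G n t) \<le> ennreal (1 - p) * emeasure M (H n t)" for n t
    unfolding G_def H_def
  proof (rule not_left_step_le[OF low_hit_cong \<open>p \<le> 1\<close>])
    fix z assume z: "low_hit k T n t z"
    then have "w (visits z t (z t - 1)) \<le> w T"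
      using visits_below_le[OF z] \<open>mono w\<close> unfolding low_hit_def by (auto dest: monoD)
    moreover have "w 0 \<le> w (visits z t (z t + 1))"
      using \<open>mono w\<close> by (auto dest: monoD)
    \<comment> \<open>This is the desired bound with denominators cleared and the common term
      \<open>w 0 * w (visits z t (z t + 1))\<close> cancelled.\<close>
    ultimately have "w 0 * w (visits z t (z t - 1)) \<le> w (visits z t (z t + 1)) * w T"
      using pos by (intro mult_mono) (auto intro: less_imp_le)
    then show "p \<le> w (visits z t (z t + 1)) / (w (visits z t (z t - 1)) + w (visits z t (z t + 1)))"
      unfolding p_def using add_pos_pos[OF pos pos]
      by (simp add: pos_divide_le_eq pos_le_divide_eq) (simp add: algebra_simps)
  qed blast
  have le: "emeasure M (\<Union>t. H n t) \<le> ennreal (1 - p) ^ n" for n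
  proof (induction n)
    case 0
    show ?case
      using emeasure_le_1 by simp
  next
    case (Suc n)
    have "(\<Union>t. H (Suc n) t) \<subseteq> (\<Union>t. G n t)"
      using low_hit_Suc_imp unfolding H_def G_def by fastforce
    then have "emeasure M (\<Union>t. H (Suc n) t) \<le> emeasure M (\<Union>t. G n t)"
      using G_sets by (intro emeasure_mono) auto
    also have "\<dots> \<le> ennreal (1 - p) * emeasure M (\<Union>t. H n t)"
    proof (rule emeasure_UN_le_cmult)
      show "disjoint_family (H n)"
        unfolding disjoint_family_on_def H_def using low_hit_unique by fastforce
    qed (use H_sets G_sets step in \<open>auto simp: G_def H_def\<close>)
    also have "\<dots> \<le> ennreal (1 - p) ^ Suc n"
      using Suc.IH by (auto intro: mult_left_mono)
    finally show ?case .
  qed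
  \<comment> \<open>A measurable set containing the bad event, since a recurrent minimum has visits
    of every number \<open>n\<close>.\<close>
  define N where "N = (\<Inter>n. \<Union>t. H n t)"
  have N_sets: "N \<in> sets M"
    unfolding N_def using H_sets by auto
  have "measure M N \<le> (1 - p) ^ n" for n
  proof -
    have "emeasure M N \<le> emeasure M (\<Union>t. H n t)"
      unfolding N_def using H_sets by (intro emeasure_mono) auto
    also have "\<dots> \<le> ennreal ((1 - p) ^ n)"
      using le[of n] p by (simp add: ennreal_power)
    finally show ?thesis
      using p by (simp add: emeasure_eq_measure)
  qed
  moreover have "(\<lambda>n. (1 - p) ^ n) \<longlonglongrightarrow> 0"
    using p by (intro LIMSEQ_realpow_zero) auto
  ultimately have "measure M N \<le> 0"
    by (intro LIMSEQ_le_const) auto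
  then have "N \<in> null_sets M"
    using N_sets by (auto simp: null_sets_def emeasure_eq_measure measure_le_0_iff)
  then show ?thesis
    by (rule AE_I') (auto simp: N_def H_def intro!: low_hit_exists)
qed

end

theorem theorem3p1:
  fixes M :: "'a measure" and w :: "nat \<Rightarrow> real" and Z :: "nat \<Rightarrow> 'a \<Rightarrow> int"
  assumes "\<And>n. w n > 0"
    and "mono w"
    and "filterlim w at_top sequentially"
    and "vertex_repelling_walk M w Z"
  shows "\<P>(\<omega> in M. \<exists>t0>0. \<exists>k l. k \<le> l \<and> (\<forall>t\<ge>t0. Z t \<omega> \<in> {k..l})) = 0"
proof -
  interpret vertex_repelling_walk M w Z by fact
  \<comment> \<open>\<open>T\<close> and \<open>k\<close> range over countable types, so one null
    set serves for all of them.\<close>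
  have "AE \<omega> in M. \<forall>T k. \<not> ((\<forall>s\<ge>T. k \<le> Z s \<omega>) \<and> (\<exists>\<^sub>\<infinity>s. Z s \<omega> = k))"
    using AE_not_recurrent_minimum[OF assms(1,2)] by (simp only: AE_all_countable) blast
  then have "AE \<omega> in M. \<not> (\<exists>t0>0. \<exists>k l. k \<le> l \<and> (\<forall>t\<ge>t0. Z t \<omega> \<in> {k..l}))"
    by eventually_elim (metis bounded_path_least_recurrent)
  \<comment> \<open>For a measurable event, probability zero is equivalent to its almost sure
    failure.\<close>
  moreover have "Measurable.pred M (\<lambda>\<omega>. \<exists>t0>0. \<exists>k l. k \<le> l \<and> (\<forall>t\<ge>t0. Z t \<omega> \<in> {k..l}))"
    by measurable
  ultimately show ?thesis
    by (simp add: prob_Collect_eq_0 pred_def)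
qed

end
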